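(* Let $n$ be a positive integer, let $k\geq 2$ be an integer, and let $f,f':V(P_n)\to\{1,\ldots,k\}$ be $k$-color weak maximizers of $W$ on $P_n$. If $\mathrm{type}(f)\prec\mathrm{type}(f')$ and $\mathrm{type}(f)\neq\mathrm{type}(f')$, then $W(f)<W(f')$.
   Context: $P_n$ is the path on $n$ vertices. For a finite simple connected graph $G$ and $A\subseteq V(G)$, $W(A)=\sum_{\{u,v\}\in\binom{A}{2}}d_G(u,v)$, with $d_G$ the shortest-path distance. A $k$-coloring of $G$ is any function $f:V(G)\to\{1,\ldots,k\}$; $\mathrm{type}(f)$ is the $k$-tuple of the cardinalities $|f^{-1}(1)|,\ldots,|f^{-1}(k)|$ arranged in non-decreasing order, and $W(f)=\sum_{i=1}^k W(f^{-1}(i))$. For $k\geq 2$, $f$ is a $k$-color weak maximizer of $W$ on $G$ if $f$ is surjective and $W(f)\geq W(f')$ for all surjective $f':V(G)\to\{1,\ldots,k\}$ with $\mathrm{type}(f')=\mathrm{type}(f)$. Majorization: for $x\in\mathbb{R}^k$ let $x_{[1]}\geq\cdots\geq x_{[k]}$ be its components in non-increasing order. For $x,y\in\mathbb{R}^k$, $x\prec y$ means $\sum_{j=1}^s x_{[j]}\leq\sum_{j=1}^s y_{[j]}$ for $s=1,\ldots,k-1$ and $\sum_{j=1}^k x_{[j]}=\sum_{j=1}^k y_{[j]}$. *)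

theory Defs
  imports "Graph_Theory.Graph_Theory" "HOL-Library.Ramsey" "HOL-Library.FuncSet"
begin

text \<open>
  Finite simple graphs are digraphs of the AFP entry Graph_Theory that satisfy the locale
  \<^locale>\<open>graph\<close> (finite, loop-free, symmetric arc set, no parallel arcs).
\<close>

text \<open>
  The path on the vertices \<open>1, \<dots>, n\<close>; every edge is represented by its two orientations.
\<close>

definition path_graph :: "nat \<Rightarrow> nat pair_pre_digraph" where
  "path_graph n = \<lparr> pverts = {1..n},
     parcs = {(i, j). i \<in> {1..n} \<and> j \<in> {1..n} \<and> (j = i + 1 \<or> i = j + 1)} \<rparr>"

text \<open>
  With unit weights the cost of a walk is its number of arcs, so the library's shortest-path
  value is the shortest-path distance. In a connected graph it is a finite number, and
  \<^const>\<open>real_of_ereal\<close> merely changes its type.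
\<close>

definition graph_dist :: "('v, 'e) pre_digraph \<Rightarrow> 'v \<Rightarrow> 'v \<Rightarrow> real" where
  "graph_dist G u v = real_of_ereal (wf_digraph.\<mu> G (\<lambda>_. 1) u v)"

text \<open>
  The sum ranges over the unordered pairs (2-subsets) of \<open>A\<close>. The definite description is well
  defined because the distance is symmetric.
\<close>

definition wiener_set :: "('v, 'e) pre_digraph \<Rightarrow> 'v set \<Rightarrow> real" where
  "wiener_set G A = (\<Sum>e\<in>nsets A 2. THE d. \<exists>u v. e = {u, v} \<and> d = graph_dist G u v)"

text \<open>
  Colorings are total functions of which only the values on the vertex set matter; hence color
  classes are intersected with the vertex set.
\<close>

definition coloring :: "('v, 'e) pre_digraph \<Rightarrow> nat \<Rightarrow> ('v \<Rightarrow> nat) \<Rightarrow> bool" where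
  "coloring G k f \<longleftrightarrow> f \<in> verts G \<rightarrow> {1..k}"

definition color_class :: "('v, 'e) pre_digraph \<Rightarrow> ('v \<Rightarrow> nat) \<Rightarrow> nat \<Rightarrow> 'v set" where
  "color_class G f i = {v \<in> verts G. f v = i}"

definition coloring_type :: "('v, 'e) pre_digraph \<Rightarrow> nat \<Rightarrow> ('v \<Rightarrow> nat) \<Rightarrow> nat list" where
  "coloring_type G k f = sort (map (\<lambda>i. card (color_class G f i)) [1..<k + 1])"

definition wiener_coloring :: "('v, 'e) pre_digraph \<Rightarrow> nat \<Rightarrow> ('v \<Rightarrow> nat) \<Rightarrow> real" where
  "wiener_coloring G k f = (\<Sum>i = 1..k. wiener_set G (color_class G f i))"

definition surj_coloring :: "('v, 'e) pre_digraph \<Rightarrow> nat \<Rightarrow> ('v \<Rightarrow> nat) \<Rightarrow> bool" where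
  "surj_coloring G k f \<longleftrightarrow> coloring G k f \<and> f ` verts G = {1..k}"

definition weak_maximizer :: "('v, 'e) pre_digraph \<Rightarrow> nat \<Rightarrow> ('v \<Rightarrow> nat) \<Rightarrow> bool" where
  "weak_maximizer G k f \<longleftrightarrow> surj_coloring G k f \<and>
     (\<forall>f'. surj_coloring G k f' \<and> coloring_type G k f' = coloring_type G k f \<longrightarrow>
        wiener_coloring G k f' \<le> wiener_coloring G k f)"

text \<open>
  Vectors in \<open>\<real>\<^sup>k\<close> are lists of length \<open>k\<close>; \<open>decr_component x j\<close> is the \<open>j\<close>-th largest component,
  for \<open>1 \<le> j \<le> k\<close>.
\<close>

definition decr_component :: "real list \<Rightarrow> nat \<Rightarrow> real" where
  "decr_component x j = rev (sort x) ! (j - 1)"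

definition majorized :: "nat \<Rightarrow> real list \<Rightarrow> real list \<Rightarrow> bool" where
  "majorized k x y \<longleftrightarrow> length x = k \<and> length y = k \<and>
     (\<forall>s\<in>{1..k - 1}. (\<Sum>j = 1..s. decr_component x j) \<le> (\<Sum>j = 1..s. decr_component y j)) \<and>
     (\<Sum>j = 1..k. decr_component x j) = (\<Sum>j = 1..k. decr_component y j)"

lemma path_graph_simps:
  "pverts (path_graph n) = {1..n}"
  "(i, j) \<in> parcs (path_graph n) \<longleftrightarrow> i \<in> {1..n} \<and> j \<in> {1..n} \<and> (j = i + 1 \<or> i = j + 1)"
  by (auto simp: path_graph_def)

lemma pair_graph_path_graph: "pair_graph (path_graph n)"
  by unfold_locales
     (auto simp: path_graph_def symmetric_def sym_def intro: finite_subset[of _ "{1..n} \<times> {1..n}"])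

lemma graph_path_graph: "graph (with_proj (path_graph n))"
  using pair_graph_path_graph by (rule pair_graph.pair_graphD_graph)

lemma path_graph_walk:
  assumes "i \<in> {1..n}" "j \<in> {1..n}"
  shows "\<exists>p. pre_digraph.awalk (with_proj (path_graph n)) i p j \<and>
    real (length p) = \<bar>real i - real j\<bar>"
proof -
  interpret pair_graph "path_graph n" by (rule pair_graph_path_graph)
  have up: "\<exists>p. awalk a p (a + m) \<and> length p = m" if "1 \<le> a" "a + m \<le> n" for a m
    using that
  proof (induction m arbitrary: a)
    case 0
    then show ?case by (intro exI[of _ "[]"]) (auto simp: awalk_Nil_iff path_graph_simps)
  next
    case (Suc m)
    then obtain p where "awalk (a + 1) p (a + 1 + m)" "length p = m" by force
    with Suc.prems show ?case
      by (intro exI[of _ "(a, a + 1) # p"]) (auto simp: awalk_Cons_iff path_graph_simps)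
  qed
  have down: "\<exists>p. awalk (a + m) p a \<and> length p = m" if "1 \<le> a" "a + m \<le> n" for a m
    using that
  proof (induction m)
    case 0
    then show ?case by (intro exI[of _ "[]"]) (auto simp: awalk_Nil_iff path_graph_simps)
  next
    case (Suc m)
    then obtain p where "awalk (a + m) p a" "length p = m" by force
    with Suc.prems show ?case
      by (intro exI[of _ "(a + Suc m, a + m) # p"]) (auto simp: awalk_Cons_iff path_graph_simps)
  qed
  show ?thesis
  proof (cases "i \<le> j")
    case True
    then show ?thesis using up[of i "j - i"] assms by fastforce
  next
    case False
    then show ?thesis using down[of j "i - j"] assms by fastforce
  qed
qed

lemma connected_path_graph:
  assumes "n \<ge> 1"
  shows "connected (with_proj (path_graph n))"
proof -
  interpret pair_graph "path_graph n" by (rule pair_graph_path_graph)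
  have "strongly_connected (with_proj (path_graph n))"
    unfolding strongly_connected_def
    using path_graph_walk[of _ n] assms
    by (fastforce simp: reachable_awalk path_graph_simps)
  moreover have "mk_symmetric (with_proj (path_graph n)) = path_graph n"
    by (force simp: mk_symmetric_def path_graph_def)
  ultimately show ?thesis by (simp add: connected_def)
qed

lemma graph_dist_path_graph:
  assumes "i \<in> {1..n}" "j \<in> {1..n}"
  shows "graph_dist (with_proj (path_graph n)) i j = \<bar>real i - real j\<bar>"
proof -
  interpret pair_graph "path_graph n" by (rule pair_graph_path_graph)
  have lower: "\<bar>real a - real b\<bar> \<le> real (length p)" if "awalk a p b" for a b p
    using that
  proof (induction p arbitrary: a)
    case Nil
    then show ?case by (simp add: awalk_Nil_iff)
  next
    case (Cons e p)
    then have "\<bar>real (snd e) - real b\<bar> \<le> real (length p)" "e \<in> parcs (path_graph n)" "fst e = a"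
      by (auto simp: awalk_Cons_iff)
    then show ?case by (cases e) (auto simp: path_graph_simps)
  qed
  obtain p where p: "awalk i p j" "real (length p) = \<bar>real i - real j\<bar>"
    using path_graph_walk[OF assms] by blast
  have cost: "awalk_cost (\<lambda>_. 1) q = real (length q)" for q
    by (induction q) auto
  have "\<mu> (\<lambda>_. 1) i j = ereal \<bar>real i - real j\<bar>"
    unfolding \<mu>_def cost
  proof (rule antisym)
    show "(INF p\<in>{p. awalk i p j}. ereal (real (length p))) \<le> ereal \<bar>real i - real j\<bar>"
      using p by (intro INF_lower2[of p]) auto
    show "ereal \<bar>real i - real j\<bar> \<le> (INF p\<in>{p. awalk i p j}. ereal (real (length p)))"
      using lower by (intro INF_greatest) auto
  qed
  then show ?thesis by (simp add: graph_dist_def)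
qed

lemma wiener_set_path_graph_summand:
  assumes "i \<in> {1..n}" "j \<in> {1..n}"
  shows "(THE d. \<exists>u v. {i, j} = {u, v} \<and> d = graph_dist (with_proj (path_graph n)) u v)
    = \<bar>real i - real j\<bar>"
proof (rule the_equality)
  show "\<exists>u v. {i, j} = {u, v} \<and> \<bar>real i - real j\<bar> = graph_dist (with_proj (path_graph n)) u v"
    using graph_dist_path_graph[OF assms] by metis
next
  fix d
  assume "\<exists>u v. {i, j} = {u, v} \<and> d = graph_dist (with_proj (path_graph n)) u v"
  then show "d = \<bar>real i - real j\<bar>"
    using graph_dist_path_graph[OF assms] graph_dist_path_graph[OF assms(2,1)]
    by (auto simp: doubleton_eq_iff)
qed

end

theory Submission
  imports Defs "HOL-Combinatorics.List_Permutation"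
begin

text \<open>
  A pair of vertices \<open>u < v\<close> of the path is separated by exactly \<open>v - u\<close> edges. Hence \<open>W(A)\<close> is the
  sum, over all edges, of the product of the numbers of vertices of \<open>A\<close> on the two sides of that
  edge (lemma \<open>wiener_set_eq_sum_cuts\<close>).

  The heart of the proof concerns two disjoint classes \<open>A\<close> and \<open>B\<close> with \<open>|A| \<ge> |B| \<ge> 1\<close>: the set
  \<open>A \<union> B\<close> can be redistributed into classes of sizes \<open>|A| + 1\<close> and \<open>|B| - 1\<close> with a strictly larger
  total (lemma \<open>exists_better_unbalanced_pair\<close>). At a given edge, let \<open>S\<close> be the excess of \<open>A\<close> over
  \<open>B\<close> to the left of the edge, and let \<open>D = |A| - |B|\<close>. Up to a term that depends only on \<open>A \<union> B\<close>,
  twice the contribution of the edge is \<open>S (D - S)\<close>. It is large when \<open>S\<close> is close to \<open>D / 2\<close>, and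
  the bound \<open>D\<^sup>2 / 4\<close> grows with \<open>D\<close>. After the redistribution \<open>D\<close> is replaced by \<open>D + 2\<close>. If the new
  first class takes the outermost vertices of the union on both sides and the classes alternate in between, then
  the new excess climbs at full speed to about \<open>(D + 2) / 2\<close>, oscillates near it, and finally climbs at full
  speed to \<open>D + 2\<close>. Since no excess can climb faster, this is at least as good as the old excess at
  every edge, and strictly better where the first climb ends.

  The theorem follows because a majorization between integer vectors decomposes into unit transfers
  from a smaller to a larger entry. Starting from \<open>f\<close>, with its colors renamed so that the class
  sizes decrease, such transfers lead to a coloring \<open>g\<close> with \<open>W(f) < W(g)\<close> whose type is that of
  \<open>f'\<close> (lemma \<open>exists_better_coloring_majorizing\<close>). As \<open>f'\<close> maximizes \<open>W\<close> among the surjective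
  colorings of its type, \<open>W(g) \<le> W(f')\<close>.
\<close>

section \<open>Cuts\<close>

text \<open>
  The number \<open>t\<close> stands for the edge between \<open>t\<close> and \<open>t + 1\<close>; the summand at \<open>t = 0\<close> vanishes. The
  distance of \<open>u < v\<close> counts the \<open>t\<close> with \<open>u \<le> t < v\<close>, and exchanging the two summations makes the
  sum over pairs factor.
\<close>

lemma wiener_set_eq_sum_cuts:
  assumes A: "A \<subseteq> {1..n}"
  shows "wiener_set (with_proj (path_graph n)) A
    = (\<Sum>t<n. real (card (A \<inter> {..t})) * real (card (A \<inter> {t<..})))"
proof -
  let ?P = "{(u, v). u \<in> A \<and> v \<in> A \<and> u < v}"
  let ?d = "\<lambda>e. THE d. \<exists>u v. e = {u, v} \<and> d = graph_dist (with_proj (path_graph n)) u v"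
  have fin: "finite A" using A finite_subset by blast
  have bij: "bij_betw (\<lambda>(u, v). {u, v}) ?P (nsets A 2)"
  proof (rule bij_betw_imageI)
    show "inj_on (\<lambda>(u, v). {u, v}) ?P"
      by (auto simp: inj_on_def doubleton_eq_iff)
    show "(\<lambda>(u, v). {u, v}) ` ?P = nsets A 2"
    proof (intro equalityI subsetI)
      fix e assume "e \<in> nsets A 2"
      then obtain u v where "e = {u, v}" "u \<in> A" "v \<in> A" "u \<noteq> v"
        by (auto simp: nsets_def card_2_iff)
      then have "(min u v, max u v) \<in> ?P" "e = {min u v, max u v}"
        by (auto simp: min_def max_def)
      then show "e \<in> (\<lambda>(u, v). {u, v}) ` ?P" by force
    qed (auto simp: nsets_def)
  qed
  have "wiener_set (with_proj (path_graph n)) A = (\<Sum>(u, v)\<in>?P. ?d {u, v})"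
    unfolding wiener_set_def using sum.reindex_bij_betw[OF bij, of ?d]
    by (simp add: case_prod_unfold)
  also have "\<dots> = (\<Sum>(u, v)\<in>?P. real (v - u))"
    using A by (intro sum.cong) (auto simp: subset_iff wiener_set_path_graph_summand)
  \<comment> \<open>Truncated subtraction makes the pairs with \<open>u \<ge> v\<close> contribute \<open>0\<close>.\<close>
  also have "\<dots> = (\<Sum>(u, v)\<in>A \<times> A. real (v - u))"
    using fin by (intro sum.mono_neutral_left) auto
  also have "\<dots> = (\<Sum>(u, v)\<in>A \<times> A. \<Sum>t<n. of_bool (u \<le> t) * of_bool (t < v))"
  proof (intro sum.cong refl, clarify)
    fix u v assume "u \<in> A" "v \<in> A"
    then have "{..<n} \<inter> {t. u \<le> t \<and> t < v} = {u..<v}" using A by auto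
    then show "real (v - u) = (\<Sum>t<n. of_bool (u \<le> t) * of_bool (t < v))"
      by (simp flip: of_bool_conj)
  qed
  also have "\<dots> = (\<Sum>t<n. \<Sum>(u, v)\<in>A \<times> A. of_bool (u \<le> t) * of_bool (t < v))"
    unfolding case_prod_unfold by (rule sum.swap)
  also have "\<dots> = (\<Sum>t<n. (\<Sum>u\<in>A. of_bool (u \<le> t)) * (\<Sum>v\<in>A. of_bool (t < v)))"
    by (simp add: sum_product sum.cartesian_product)
  also have "\<dots> = (\<Sum>t<n. real (card (A \<inter> {..t})) * real (card (A \<inter> {t<..})))"
    using fin by (simp add: atMost_def greaterThan_def)
  finally show ?thesis .
qed

text \<open>
  Two classes of sizes \<open>p\<close> and \<open>q\<close> have \<open>a\<close> and \<open>b\<close> vertices to the left of a cut. The first summand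
  on the right depends only on the union of the two classes, so comparing two ways to split that
  union amounts to comparing the excess \<open>a - b\<close>.
\<close>

lemma cut_excess:
  fixes a p b q :: int
  shows "2 * (a * (p - a) + b * (q - b))
    = (a + b) * (p + q - (a + b)) + (a - b) * ((p - q) - (a - b))"
  by algebra

section \<open>Moving one vertex from a smaller class to a larger one\<close>

text \<open>
  The excess after the \<open>r\<close> leftmost elements of the union, when the first class consists of the first
  \<open>c\<close> elements, every second one of the next \<open>M\<close> elements, and all later ones.
\<close>

definition profile :: "nat \<Rightarrow> nat \<Rightarrow> nat \<Rightarrow> int" where
  "profile c M r = (if r \<le> c then int r else if r \<le> c + M then int (c + (r - c) mod 2)
     else int r - int M)"

text \<open>
  The elements of rank at most \<open>r\<close> in the two classes number \<open>r\<close> together and differ by the excess,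
  so their sum and difference together give twice the size of the first part. Evenness of \<open>M\<close> makes the oscillation end at height \<open>c\<close>, where
  the final slope begins.
\<close>

lemma card_steps_eq_profile:
  assumes "even M"
  shows "2 * int (card {s \<in> {1..r}. s \<le> c \<or> c + M < s \<or> odd (s - c)}) = int r + profile c M r"
proof (induction r)
  case 0
  then show ?case by (simp add: profile_def)
next
  case (Suc r)
  let ?Q = "\<lambda>s. s \<le> c \<or> c + M < s \<or> odd (s - c)"
  have count: "int (card {s \<in> {1..Suc r}. Q s})
      = int (card {s \<in> {1..r}. Q s}) + of_bool (Q (Suc r))" for Q
  proof -
    have "{s \<in> {1..Suc r}. Q s}
      = (if Q (Suc r) then insert (Suc r) {s \<in> {1..r}. Q s} else {s \<in> {1..r}. Q s})"
      by (auto simp: le_Suc_eq)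
    then show ?thesis by simp
  qed
  moreover have "profile c M (Suc r) = profile c M r + (2 * of_bool (?Q (Suc r)) - 1)"
  proof -
    consider "Suc r \<le> c" | "c \<le> r" "Suc r \<le> c + M" | "r = c + M" | "c + M < r" by linarith
    then show ?thesis
    proof cases
      case 2
      then obtain d where d: "r = c + d" using le_Suc_ex by blast
      show ?thesis using 2 d by (cases "even d") (auto simp: profile_def mod_2_eq_odd Suc_diff_le odd_pos)
    next
      case 3
      then show ?thesis using assms by (auto simp: profile_def mod_2_eq_odd)
    qed (auto simp: profile_def)
  qed
  ultimately show ?case using Suc count[of ?Q] by linarith
qed

text \<open>
  The rank \<open>v \<mapsto> |U \<inter> {..v}|\<close> maps \<open>U \<inter> {..t}\<close> bijectively onto an initial segment of the positive
  integers, so subsets of \<open>U\<close> that are selected by rank can be counted there.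
\<close>

lemma card_rank_selection:
  fixes U :: "nat set"
  shows "card {v \<in> U. v \<le> t \<and> Q (card (U \<inter> {..v}))} = card {r \<in> {1..card (U \<inter> {..t})}. Q r}"
proof -
  let ?rk = "\<lambda>v. card (U \<inter> {..v})"
  have mono: "?rk u < ?rk v" if "u < v" "v \<in> U" for u v
  proof -
    have "v \<in> U \<inter> {..v}" "v \<notin> U \<inter> {..u}" "U \<inter> {..u} \<subseteq> U \<inter> {..v}" using that by auto
    then show ?thesis by (intro psubset_card_mono) blast+
  qed
  have inj: "inj_on ?rk (U \<inter> {..t})"
    by (rule inj_onI) (metis IntE linorder_neqE_nat mono nat_neq_iff)
  have "?rk ` (U \<inter> {..t}) \<subseteq> {1..?rk t}"
    by (auto simp: Suc_le_eq card_gt_0_iff intro!: card_mono)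
  moreover have "card (?rk ` (U \<inter> {..t})) = card {1..?rk t}"
    using inj by (simp add: card_image)
  ultimately have img: "?rk ` (U \<inter> {..t}) = {1..?rk t}"
    by (intro card_subset_eq) auto
  have "bij_betw ?rk {v \<in> U. v \<le> t \<and> Q (?rk v)} {r \<in> {1..?rk t}. Q r}"
  proof (rule bij_betw_imageI)
    show "inj_on ?rk {v \<in> U. v \<le> t \<and> Q (?rk v)}"
      using inj by (rule inj_on_subset) auto
    show "?rk ` {v \<in> U. v \<le> t \<and> Q (?rk v)} = {r \<in> {1..?rk t}. Q r}"
      unfolding img[symmetric] by auto
  qed
  then show ?thesis by (rule bij_betw_same_card)
qed

text \<open>
  On the initial slope the new excess is \<open>r\<close>, the largest value that an excess can have after \<open>r\<close>
  elements. For \<open>S \<ge> 0\<close> the inequality combines the increase of \<open>s \<mapsto> s (D + 2 - s)\<close> up to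
  \<open>(D + 2) / 2\<close> with \<open>S (D - S) \<le> S (D + 2 - S)\<close>; for \<open>S < 0\<close> the left-hand side is negative.
\<close>

lemma initial_slope_beats:
  fixes D S r :: int
  assumes "0 \<le> D" "S \<le> r" "0 \<le> r" "2 * r \<le> D + 2"
  shows "S * (D - S) \<le> r * (D + 2 - r)"
proof (cases "0 \<le> S")
  case True
  have "0 \<le> (r - S) * (D + 2 - r - S)" using assms by simp
  with True show ?thesis by (simp add: algebra_simps)
next
  case False
  then have "S * (D - S) \<le> 0" using assms by (intro mult_nonpos_nonneg) linarith+
  also have "\<dots> \<le> r * (D + 2 - r)" using assms by simp
  finally show ?thesis .
qed

text \<open>
  On the plateau the new excess \<open>z\<close> is within distance \<open>1\<close> of \<open>(D + 2) / 2\<close>. Completing squares, the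
  old value is at most \<open>D\<^sup>2 / 4\<close> and the new one at least \<open>(D + 2)\<^sup>2 / 4 - 1 = D\<^sup>2 / 4 + D\<close>. By
  integrality the loss \<open>1\<close> drops to at most \<open>1 / 4\<close> away from the two extreme values of \<open>z\<close>, which
  gives strictness even for \<open>D = 0\<close>.
\<close>

lemma plateau_beats:
  fixes D S z :: int
  assumes "0 \<le> D" "D \<le> 2 * z" "2 * z \<le> D + 4"
  shows "S * (D - S) \<le> z * (D + 2 - z)"
    and "2 * z \<noteq> D \<Longrightarrow> 2 * z \<noteq> D + 4 \<Longrightarrow> S * (D - S) < z * (D + 2 - z)"
proof -
  have S: "4 * (S * (D - S)) = D^2 - (D - 2 * S)^2" by algebra
  have z: "4 * (z * (D + 2 - z)) = (D + 2)^2 - (D + 2 - 2 * z)^2" by algebra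
  have "\<bar>D + 2 - 2 * z\<bar> \<le> 2" using assms by linarith
  then have "(D + 2 - 2 * z)^2 \<le> 2^2" using abs_le_square_iff[of "D + 2 - 2 * z" 2] by simp
  then have "D^2 \<le> (D + 2)^2 - (D + 2 - 2 * z)^2"
    using assms by (simp add: power2_sum)
  with S z show "S * (D - S) \<le> z * (D + 2 - z)"
    using zero_le_power2[of "D - 2 * S"] by linarith
  assume "2 * z \<noteq> D" "2 * z \<noteq> D + 4"
  then have "\<bar>D + 2 - 2 * z\<bar> \<le> 1" using assms by linarith
  then have "(D + 2 - 2 * z)^2 \<le> 1^2" using abs_le_square_iff[of "D + 2 - 2 * z" 1] by simp
  then have "D^2 < (D + 2)^2 - (D + 2 - 2 * z)^2"
    using assms by (simp add: power2_sum)
  with S z show "S * (D - S) < z * (D + 2 - z)"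
    using zero_le_power2[of "D - 2 * S"] by linarith
qed

text \<open>
  The hypotheses on \<open>S\<close> say that the old excess has grown by at most \<open>r\<close> so far, and that the number of
  remaining elements suffices for it to reach its final value \<open>d\<close>. The final slope is the
  mirror image of the initial one, with \<open>d - S\<close> in the role of \<open>S\<close>.
\<close>

lemma profile_beats:
  fixes S :: int and d c M r :: nat
  assumes c: "c = (d + 2) div 2" and S: "S \<le> int r" "int d - S \<le> int (d + 2 + M) - int r"
    and r: "r \<le> d + 2 + M"
  shows "S * (int d - S) \<le> profile c M r * (int d + 2 - profile c M r)"
    and "r = c \<Longrightarrow> S * (int d - S) < profile c M r * (int d + 2 - profile c M r)"
proof -
  have c2: "2 * int c \<le> int d + 2" "int d + 1 \<le> 2 * int c" using c by linarith+
  show "S * (int d - S) \<le> profile c M r * (int d + 2 - profile c M r)"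
  proof -
    consider "r \<le> c" | "c < r" "r \<le> c + M" | "c + M < r" by linarith
    then show ?thesis
    proof cases
      case 1
      then show ?thesis using initial_slope_beats[of "int d" S "int r"] S c2
        by (simp add: profile_def)
    next
      case 2
      have "(r - c) mod 2 \<le> 1" by simp
      with 2 c2 show ?thesis
        by (intro plateau_beats(1)) (auto simp: profile_def)
    next
      case 3
      define w where "w = int (d + 2 + M) - int r"
      have "(int d - S) * (int d - (int d - S)) \<le> w * (int d + 2 - w)"
        using 3 S c2 r by (intro initial_slope_beats) (auto simp: w_def)
      moreover have "profile c M r = int d + 2 - w"
        using 3 by (simp add: profile_def w_def)
      ultimately show ?thesis by (simp add: mult.commute)
    qed
  qed
  show "S * (int d - S) < profile c M r * (int d + 2 - profile c M r)" if "r = c"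
    using that c2 by (intro plateau_beats(2)) (auto simp: profile_def)
qed

lemma exists_cut_of_rank:
  fixes U :: "nat set"
  assumes "0 \<notin> U" "c \<le> card (U \<inter> {..n})"
  shows "\<exists>t\<le>n. card (U \<inter> {..t}) = c"
proof -
  have "\<forall>i<n. \<bar>int (card (U \<inter> {..Suc i})) - int (card (U \<inter> {..i}))\<bar> \<le> 1"
    by (auto simp: atMost_Suc Int_insert_right)
  then have "\<exists>t\<le>n. int (card (U \<inter> {..t})) = int c"
    using assms by (intro nat0_intermed_int_val) auto
  then show ?thesis by simp
qed

text \<open>
  The new first class \<open>A'\<close> is selected by rank so that its excess follows \<open>profile\<close>. This is at least
  as good as the given pair at every cut, and strictly better at a cut with exactly \<open>c\<close> elements of
  the union on its left, of which there is one because \<open>1 \<le> c < |A \<union> B|\<close>.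
\<close>

lemma exists_better_unbalanced_pair:
  assumes AB: "A \<subseteq> {1..n}" "B \<subseteq> {1..n}" "A \<inter> B = {}" and q: "card B \<le> card A" "B \<noteq> {}"
  shows "\<exists>A' B'. A' \<inter> B' = {} \<and> A' \<union> B' = A \<union> B \<and> card A' = card A + 1 \<and> card B' = card B - 1 \<and>
    wiener_set (with_proj (path_graph n)) A + wiener_set (with_proj (path_graph n)) B
    < wiener_set (with_proj (path_graph n)) A' + wiener_set (with_proj (path_graph n)) B'"
proof -
  let ?W = "wiener_set (with_proj (path_graph n))"
  define U where "U = A \<union> B"
  define \<tau> where "\<tau> t = card (U \<inter> {..t})" for t
  \<comment> \<open>The slopes have total length \<open>d + 2\<close>, the new difference of sizes; the rest, of even length
    \<open>|A| + |B| - (d + 2) = 2 (|B| - 1)\<close>, is left for the plateau.\<close>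
  define d c M where "d = card A - card B" and "c = (d + 2) div 2" and "M = 2 * (card B - 1)"
  define A' where "A' = {v \<in> U. \<tau> v \<le> c \<or> c + M < \<tau> v \<or> odd (\<tau> v - c)}"
  define B' where "B' = U - A'"
  let ?cut = "\<lambda>X Y t. int (card (X \<inter> {..t})) * int (card (X \<inter> {t<..}))
    + int (card (Y \<inter> {..t})) * int (card (Y \<inter> {t<..}))"
  have fin: "finite A" "finite B" using AB finite_subset by blast+
  have finU: "finite U" using fin by (simp add: U_def)
  have Usub: "U \<subseteq> {1..n}" using AB by (auto simp: U_def)
  have B1: "1 \<le> card B" using q fin by (simp add: Suc_le_eq card_gt_0_iff)
  have cU: "card U = card A + card B" using fin AB by (simp add: U_def card_Un_disjoint)
  have cUd: "card U = d + 2 + M" using cU q B1 by (simp add: d_def M_def)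
  have A'sub: "A' \<subseteq> U" and B'sub: "B' \<subseteq> U" and disj: "A' \<inter> B' = {}" and un: "A' \<union> B' = U"
    by (auto simp: A'_def B'_def)
  have split: "card (X \<inter> {..t}) + card (X \<inter> {t<..}) = card X" if "finite X" for X and t :: nat
  proof -
    have "X = X \<inter> {..t} \<union> X \<inter> {t<..}" by auto
    moreover have "(X \<inter> {..t}) \<inter> (X \<inter> {t<..}) = {}" by auto
    ultimately show ?thesis using that by (metis card_Un_disjoint finite_Int)
  qed
  have cutsum: "?W X + ?W Y = real_of_int (\<Sum>t<n. ?cut X Y t)" if "X \<subseteq> U" "Y \<subseteq> U" for X Y
    using that Usub by (simp add: wiener_set_eq_sum_cuts sum.distrib)
  have union_cut: "\<tau> t = card (X \<inter> {..t}) + card (Y \<inter> {..t})"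
    if XY: "X \<inter> Y = {}" "X \<union> Y = U" for X Y t
    unfolding \<tau>_def XY(2)[symmetric] Int_Un_distrib2
    using XY finU by (intro card_Un_disjoint) (auto simp flip: XY(2))
  have cut: "2 * ?cut X Y t = int (\<tau> t) * (int (card U) - int (\<tau> t))
      + (int (card (X \<inter> {..t})) - int (card (Y \<inter> {..t})))
        * ((int (card X) - int (card Y)) - (int (card (X \<inter> {..t})) - int (card (Y \<inter> {..t}))))"
    if XY: "X \<inter> Y = {}" "X \<union> Y = U" for X Y t
  proof -
    have fXY: "finite X" "finite Y" using XY finU by (metis finite_Un)+
    note union_cut[OF XY, of t]
    moreover have "card U = card X + card Y"
      using fXY XY by (metis card_Un_disjoint)
    moreover have "int (card (X \<inter> {t<..})) = int (card X) - int (card (X \<inter> {..t}))"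
      "int (card (Y \<inter> {t<..})) = int (card Y) - int (card (Y \<inter> {..t}))"
      using split[OF fXY(1), of t] split[OF fXY(2), of t] by linarith+
    ultimately show ?thesis using cut_excess
      by (simp only: of_nat_add)
  qed
  have count_A': "2 * int (card (A' \<inter> {..t})) = int (\<tau> t) + profile c M (\<tau> t)" for t
  proof -
    have "A' \<inter> {..t} = {v \<in> U. v \<le> t \<and> (\<tau> v \<le> c \<or> c + M < \<tau> v \<or> odd (\<tau> v - c))}"
      by (auto simp: A'_def)
    then show ?thesis
      using card_rank_selection[of U t "\<lambda>r. r \<le> c \<or> c + M < r \<or> odd (r - c)"]
        card_steps_eq_profile[of M "\<tau> t" c]
      by (simp add: \<tau>_def M_def)
  qed
  have excess_A': "int (card (A' \<inter> {..t})) - int (card (B' \<inter> {..t})) = profile c M (\<tau> t)" for t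
    using union_cut[OF disj un, of t] count_A'[of t] by linarith
  have atn: "X \<inter> {..n} = X" if "X \<subseteq> U" for X using that Usub by auto
  have \<tau>n: "\<tau> n = card U" using atn[of U] by (simp add: \<tau>_def)
  have cle: "c \<le> d + 1" "c \<ge> 1" by (auto simp: c_def)
  have cards: "card A' = card A + 1" "card B' = card B - 1"
  proof -
    have "profile c M (card U) = int d + 2" using cle by (simp add: profile_def cUd)
    then have "2 * int (card A') = int (card U) + int d + 2"
      using count_A'[of n] atn[OF A'sub] by (simp add: \<tau>n)
    then show "card A' = card A + 1" using q by (simp add: cU d_def)
    moreover have "card U = card A' + card B'"
      using union_cut[OF disj un, of n] atn[OF A'sub] atn[OF B'sub] by (simp add: \<tau>n)
    ultimately show "card B' = card B - 1" using cU by simp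
  qed
  let ?S = "\<lambda>t. int (card (A \<inter> {..t})) - int (card (B \<inter> {..t}))"
  have U_AB: "A \<union> B = U" by (simp add: U_def)
  have Sbounds: "?S t \<le> int (\<tau> t)" "int d - ?S t \<le> int (d + 2 + M) - int (\<tau> t)" "\<tau> t \<le> d + 2 + M" for t
  proof -
    show "?S t \<le> int (\<tau> t)" using union_cut[OF AB(3) U_AB, of t] by simp
    show "int d - ?S t \<le> int (d + 2 + M) - int (\<tau> t)"
      using union_cut[OF AB(3) U_AB, of t] split[OF fin(1), of t] split[OF fin(2), of t] cU cUd q
      by (simp add: d_def)
    show "\<tau> t \<le> d + 2 + M" unfolding cUd[symmetric] \<tau>_def using finU by (intro card_mono) auto
  qed
  have DAB: "int (card A) - int (card B) = int d" using q by (simp add: d_def)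
  have DAB': "int (card A') - int (card B') = int d + 2" using q B1 by (simp add: cards d_def)
  have half_le: "u \<le> v" if "2 * u = w + s" "2 * v = w + s'" "s \<le> s'" for u v w s s' :: int
    using that by linarith
  have half_less: "u < v" if "2 * u = w + s" "2 * v = w + s'" "s < s'" for u v w s s' :: int
    using that by linarith
  have le: "?cut A B t \<le> ?cut A' B' t" for t
    using cut[OF AB(3) U_AB, of t] cut[OF disj un, of t] profile_beats(1)[OF c_def Sbounds[of t]]
    unfolding excess_A' DAB DAB' by (rule half_le)
  have lt: "?cut A B t < ?cut A' B' t" if "\<tau> t = c" for t
    using cut[OF AB(3) U_AB, of t] cut[OF disj un, of t] profile_beats(2)[OF c_def Sbounds[of t] that]
    unfolding excess_A' DAB DAB' by (rule half_less)
  have "\<exists>t\<le>n. \<tau> t = c"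
    unfolding \<tau>_def using Usub cle cUd \<tau>n
    by (intro exists_cut_of_rank) (auto simp: \<tau>_def)
  then obtain t where t: "t \<le> n" "\<tau> t = c" by blast
  moreover have "t \<noteq> n" using t(2) \<tau>n cUd cle by auto
  ultimately have tn: "t < n" by simp
  have "(\<Sum>t<n. ?cut A B t) < (\<Sum>t<n. ?cut A' B' t)"
    using le lt[OF t(2)] tn by (intro sum_strict_mono_ex1) auto
  moreover have "A \<subseteq> U" "B \<subseteq> U" using U_AB by auto
  ultimately have "?W A + ?W B < ?W A' + ?W B'"
    by (simp only: cutsum[of A B] cutsum[OF A'sub B'sub] of_int_less_iff)
  then show ?thesis using disj un cards unfolding U_def by blast
qed

section \<open>Colorings\<close>

lemma exists_better_coloring_transfer:
  fixes n :: nat and f :: "nat \<Rightarrow> nat"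
  defines "G \<equiv> with_proj (path_graph n)"
  assumes f: "coloring G k f" and ij: "i \<in> {1..k}" "j \<in> {1..k}" "i \<noteq> j"
    and le: "card (color_class G f j) \<le> card (color_class G f i)" and pos: "0 < card (color_class G f j)"
  shows "\<exists>g. coloring G k g \<and> wiener_coloring G k f < wiener_coloring G k g \<and>
    card (color_class G g i) = card (color_class G f i) + 1 \<and>
    card (color_class G g j) = card (color_class G f j) - 1 \<and>
    (\<forall>l. l \<noteq> i \<longrightarrow> l \<noteq> j \<longrightarrow> color_class G g l = color_class G f l)"
proof -
  have V: "verts G = {1..n}" by (simp add: G_def path_graph_simps)
  let ?A = "color_class G f i" and ?B = "color_class G f j"
  have AB: "?A \<subseteq> {1..n}" "?B \<subseteq> {1..n}" "?A \<inter> ?B = {}"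
    using ij(3) unfolding color_class_def V by blast+
  have "?B \<noteq> {}" using pos by force
  from exists_better_unbalanced_pair[OF AB le this, folded G_def] obtain A' B' where AB': "A' \<inter> B' = {}" "A' \<union> B' = ?A \<union> ?B" "card A' = card ?A + 1"
    "card B' = card ?B - 1" "wiener_set G ?A + wiener_set G ?B < wiener_set G A' + wiener_set G B'" by (elim exE conjE)
  define g where "g v = (if v \<in> A' then i else if v \<in> B' then j else f v)" for v
  have gi: "color_class G g i = A'" and gj: "color_class G g j = B'"
  proof -
    have *: "v \<in> A' \<or> v \<in> B' \<longleftrightarrow> v \<in> verts G \<and> (f v = i \<or> f v = j)" for v
      using AB'(2) by (auto simp: color_class_def set_eq_iff)
    show "color_class G g i = A'"
      using * ij(3) by (auto simp: color_class_def g_def)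
    show "color_class G g j = B'"
      using * ij(3) AB'(1) by (auto simp: color_class_def g_def)
  qed
  have gl: "color_class G g l = color_class G f l" if "l \<noteq> i" "l \<noteq> j" for l
  proof -
    have "v \<notin> A' \<and> v \<notin> B'" if "v \<in> verts G" "f v = l" for v
      using AB'(2) that \<open>l \<noteq> i\<close> \<open>l \<noteq> j\<close> by (auto simp: color_class_def set_eq_iff)
    then show ?thesis using \<open>l \<noteq> i\<close> \<open>l \<noteq> j\<close> by (auto simp: color_class_def g_def)
  qed
  have "wiener_coloring G k h = wiener_set G (color_class G h i) + wiener_set G (color_class G h j)
      + (\<Sum>l\<in>{1..k} - {i} - {j}. wiener_set G (color_class G h l))" for h
    unfolding wiener_coloring_def
    using ij sum.remove[of "{1..k}" i "\<lambda>l. wiener_set G (color_class G h l)"]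
      sum.remove[of "{1..k} - {i}" j "\<lambda>l. wiener_set G (color_class G h l)"] by simp
  moreover have "(\<Sum>l\<in>{1..k} - {i} - {j}. wiener_set G (color_class G g l))
      = (\<Sum>l\<in>{1..k} - {i} - {j}. wiener_set G (color_class G f l))"
    using gl by (intro sum.cong) auto
  ultimately have "wiener_coloring G k f < wiener_coloring G k g"
    using AB'(5) gi gj by simp
  moreover have "coloring G k g"
    using f ij by (auto simp: coloring_def g_def)
  ultimately show ?thesis using gi gj gl AB'(3,4) by (intro exI[of _ g]) simp
qed

text \<open>
  Each unit transfer moves some partial sums of the sizes up by one, towards those of \<open>y\<close>; the induction
  runs on the total distance that remains. Each transfer goes to the first position \<open>i\<close> where
  the sizes differ, and comes from the first position \<open>j > i\<close> where the partial sums agree again. This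
  choice keeps the sizes decreasing and the partial sums dominated. Since \<open>i < j\<close>, the donor is not
  larger than the receiver, as the redistribution of two classes requires.
\<close>

lemma exists_better_coloring_majorizing:
  fixes n :: nat and f :: "nat \<Rightarrow> nat" and y :: "nat \<Rightarrow> nat"
  defines "G \<equiv> with_proj (path_graph n)"
  assumes "coloring G k f"
    and "antimono_on {1..k} (\<lambda>i. card (color_class G f i))" and "antimono_on {1..k} y"
    and "\<And>s. s \<le> k \<Longrightarrow> (\<Sum>i=1..s. card (color_class G f i)) \<le> (\<Sum>i=1..s. y i)"
    and "(\<Sum>i=1..k. card (color_class G f i)) = (\<Sum>i=1..k. y i)"
    and "\<exists>i\<in>{1..k}. card (color_class G f i) \<noteq> y i"
  shows "\<exists>g. coloring G k g \<and> (\<forall>i\<in>{1..k}. card (color_class G g i) = y i) \<and>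
    wiener_coloring G k f < wiener_coloring G k g"
  using assms(2-)
proof (induction "\<Sum>s=1..k. (\<Sum>i=1..s. y i) - (\<Sum>i=1..s. card (color_class G f i))"
    arbitrary: f rule: less_induct)
  case less
  define x where "x i = card (color_class G f i)" for i
  define X where "X s = (\<Sum>i=1..s. x i)" for s
  define Y where "Y s = (\<Sum>i=1..s. y i)" for s
  have Suc: "X (Suc s) = X s + x (Suc s)" "Y (Suc s) = Y s + y (Suc s)" for s
    by (auto simp: X_def Y_def)
  have XY: "X s \<le> Y s" if "s \<le> k" for s using less.prems(4)[OF that] by (simp add: X_def Y_def x_def)
  have XYk: "X k = Y k" using less.prems(5) by (simp add: X_def Y_def x_def)
  have xdec: "x b \<le> x a" if "1 \<le> a" "a \<le> b" "b \<le> k" for a b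
    using less.prems(2) that by (auto simp: monotone_on_def x_def)
  have ydec: "y b \<le> y a" if "1 \<le> a" "a \<le> b" "b \<le> k" for a b
    using less.prems(3) that by (auto simp: monotone_on_def)
  define i where "i = (LEAST i. i \<in> {1..k} \<and> x i \<noteq> y i)"
  have i: "i \<in> {1..k}" "x i \<noteq> y i"
    using LeastI_ex[of "\<lambda>i. i \<in> {1..k} \<and> x i \<noteq> y i"] less.prems(6) unfolding i_def x_def by blast+
  have before: "x l = y l" if "1 \<le> l" "l < i" for l
    using not_less_Least[OF that(2)[unfolded i_def]] that i(1) by simp
  obtain i0 where i0: "i = Suc i0" using i(1) by (cases i) auto
  have "X i0 = Y i0" unfolding X_def Y_def by (rule sum.cong) (simp_all add: before i0)
  then have xi: "x i < y i" using i XY[of i] Suc[of i0] i0 by auto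
  then have XYi: "X i < Y i" using \<open>X i0 = Y i0\<close> i0 Suc[of i0] by simp
  define j where "j = (LEAST j. i \<le> j \<and> X j = Y j)"
  have j: "i \<le> j" "X j = Y j"
    using LeastI[of "\<lambda>j. i \<le> j \<and> X j = Y j" k] XYk i(1) unfolding j_def by simp_all
  have jk: "j \<le> k" unfolding j_def using XYk i by (intro Least_le) auto
  have ij: "i < j" using j XYi by (cases "i = j") auto
  have between: "X s < Y s" if "i \<le> s" "s < j" for s
  proof -
    have "X s \<noteq> Y s" using not_less_Least[OF that(2)[unfolded j_def]] that(1) by blast
    then show ?thesis using XY[of s] that(2) jk by simp
  qed
  obtain j0 where j0: "j = Suc j0" using ij by (cases j) auto
  have xj: "y j < x j" using between[of j0] ij j0 j(2) Suc[of j0] by auto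
  have after: "x l < x j" if "j < l" "l \<le> k" for l
  proof -
    have "x (Suc j) \<le> y (Suc j)" using XY[of "Suc j"] Suc[of j] j(2) that by simp
    also have "\<dots> \<le> y j" using ydec[of j "Suc j"] that ij by simp
    finally have "x (Suc j) < x j" using xj by simp
    then show ?thesis using xdec[of "Suc j" l] that by simp
  qed
  \<comment> \<open>The strict inequalities \<open>after\<close> and \<open>front\<close> leave room for the transfer: position \<open>j\<close> may lose
    one unit and position \<open>i\<close> may gain one without spoiling the decreasing order.\<close>
  have front: "x i < x l" if "1 \<le> l" "l < i" for l
    using before[OF that] ydec[of l i] that i xi by auto
  have fij: "i \<in> {1..k}" "j \<in> {1..k}" "i \<noteq> j" "x j \<le> x i" "0 < x j"
    using i(1) ij jk xdec[of i j] xj by simp_all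
  obtain g where g: "coloring G k g" "wiener_coloring G k f < wiener_coloring G k g"
    "card (color_class G g i) = x i + 1" "card (color_class G g j) = x j - 1"
    "\<forall>l. l \<noteq> i \<longrightarrow> l \<noteq> j \<longrightarrow> color_class G g l = color_class G f l"
    using exists_better_coloring_transfer[of n k f i j] less.prems(1) fij
    unfolding G_def x_def by blast
  define z where "z l = card (color_class G g l)" for l
  have z: "z l = (if l = i then x i + 1 else if l = j then x j - 1 else x l)" for l
    using g(3-5) by (simp add: z_def x_def)
  define Z where "Z s = (\<Sum>i=1..s. z i)" for s
  have Z: "Z s = X s + of_bool (i \<le> s \<and> s < j)" for s
  proof (induction s)
    case 0
    then show ?case using i by (simp add: Z_def X_def)
  next
    case (Suc s)
    have "Z (Suc s) = Z s + z (Suc s)" by (simp add: Z_def)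
    then show ?case using Suc \<open>X (Suc s) = X s + x (Suc s)\<close> ij xj
      by (auto simp: z split: if_splits)
  qed
  have ZY: "Z s \<le> Y s" if "s \<le> k" for s
    using between[of s] XY[OF that] by (auto simp: Z)
  have ZYk: "Z k = Y k" using jk XYk by (simp add: Z)
  have zdec: "antimono_on {1..k} z"
  proof (rule monotone_onI)
    fix a b assume ab: "a \<in> {1..k}" "b \<in> {1..k}" "a \<le> b"
    then show "z b \<le> z a"
      using xdec[of a b] front[of a] after[of b] ij by (auto simp: z)
  qed
  show ?case
  proof (cases "\<exists>l\<in>{1..k}. z l \<noteq> y l")
    case False
    then show ?thesis using g(1,2) by (auto simp: z_def)
  next
    case True
    have "(\<Sum>s=1..k. Y s - Z s) < (\<Sum>s=1..k. Y s - X s)"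
    proof (rule sum_strict_mono_ex1)
      show "\<forall>s\<in>{1..k}. Y s - Z s \<le> Y s - X s" by (simp add: Z diff_le_mono2)
      show "\<exists>s\<in>{1..k}. Y s - Z s < Y s - X s"
        using i ij XYi by (intro bexI[of _ i]) (auto simp: Z)
    qed simp
    then have "\<exists>h. coloring G k h \<and> (\<forall>i\<in>{1..k}. card (color_class G h i) = y i) \<and>
        wiener_coloring G k g < wiener_coloring G k h"
      unfolding X_def Y_def Z_def x_def z_def
      by (rule less.hyps[OF _ g(1) zdec[unfolded z_def] less.prems(3) ZY[unfolded Z_def Y_def z_def]
            ZYk[unfolded Z_def Y_def z_def] True[unfolded z_def]])
    then obtain h where h: "coloring G k h" "\<forall>i\<in>{1..k}. card (color_class G h i) = y i"
      "wiener_coloring G k g < wiener_coloring G k h" by (elim exE conjE)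
    show ?thesis using h(1,2) less_trans[OF g(2) h(3)] by (intro exI[of _ h] conjI)
  qed
qed

text \<open>
  Renaming the colors only permutes the summands of \<open>W\<close>. The type lists the sizes in increasing
  order, so its reversal lists them as the majorization order reads them.
\<close>

lemma relabel_by_decreasing_size:
  fixes f :: "'v \<Rightarrow> nat"
  assumes f: "coloring G k f"
  shows "\<exists>h. coloring G k h \<and> wiener_coloring G k h = wiener_coloring G k f \<and>
    (\<forall>i\<in>{1..k}. card (color_class G h i) = rev (coloring_type G k f) ! (i - 1))"
proof -
  let ?xs = "map (\<lambda>i. card (color_class G f i)) [1..<k + 1]" and ?ys = "rev (coloring_type G k f)"
  have len: "length ?xs = k" "length ?ys = k" by (auto simp: coloring_type_def)
  have "mset ?ys = mset ?xs" by (simp add: coloring_type_def)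
  then obtain p where p: "p permutes {..<length ?xs}" "permute_list p ?xs = ?ys"
    by (rule mset_eq_permutation)
  have pk: "p permutes {..<k}" using p(1) by (simp only: len)
  define r where "r i = Suc (p (i - 1))" for i
  define s where "s c = Suc (inv p (c - 1))" for c
  have rs: "s (r i) = i" if "i \<in> {1..k}" for i
    using that permutes_inverses(2)[OF pk] by (simp add: r_def s_def)
  have sr: "r (s c) = c" if "c \<in> {1..k}" for c
    using that permutes_inverses(1)[OF pk] by (simp add: r_def s_def)
  have rk: "r i \<in> {1..k}" if "i \<in> {1..k}" for i
    using that permutes_in_image[OF pk, of "i - 1"] by (auto simp: r_def)
  have sk: "s c \<in> {1..k}" if "c \<in> {1..k}" for c
    using that permutes_in_image[OF permutes_inv[OF pk], of "c - 1"] by (auto simp: s_def)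
  have cls: "color_class G (s \<circ> f) i = color_class G f (r i)" if "i \<in> {1..k}" for i
    using f that rs sr by (auto simp: color_class_def coloring_def Pi_iff)
  have bij: "bij_betw r {1..k} {1..k}"
    by (rule bij_betw_byWitness[of _ s]) (use rs sr rk sk in auto)
  have "coloring G k (s \<circ> f)" using f sk by (auto simp: coloring_def Pi_iff)
  moreover have "wiener_coloring G k (s \<circ> f) = wiener_coloring G k f"
    unfolding wiener_coloring_def
    using sum.reindex_bij_betw[OF bij, of "\<lambda>i. wiener_set G (color_class G f i)"] cls by simp
  moreover have "card (color_class G (s \<circ> f) i) = ?ys ! (i - 1)" if i: "i \<in> {1..k}" for i
  proof -
    have "?ys ! (i - 1) = ?xs ! p (i - 1)"
      using i len(1) p by (metis (no_types, lifting) One_nat_def Suc_le_lessD Suc_pred atLeastAtMost_iff permute_list_nth)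
    also have "\<dots> = card (color_class G f (r i))"
      using rk[OF i] by (simp add: r_def nth_append del: upt_Suc)
    finally show ?thesis using cls[OF i] by simp
  qed
  ultimately show ?thesis by blast
qed

theorem theorem4p4:
  fixes n k :: nat and f f' :: "nat \<Rightarrow> nat"
  assumes "n \<ge> 1" and "k \<ge> 2"
    and "weak_maximizer (with_proj (path_graph n)) k f"
    and "weak_maximizer (with_proj (path_graph n)) k f'"
    and "majorized k (map real (coloring_type (with_proj (path_graph n)) k f))
           (map real (coloring_type (with_proj (path_graph n)) k f'))"
    and "coloring_type (with_proj (path_graph n)) k f \<noteq> coloring_type (with_proj (path_graph n)) k f'"
  shows "wiener_coloring (with_proj (path_graph n)) k f
           < wiener_coloring (with_proj (path_graph n)) k f'"
proof -
  define G where "G = with_proj (path_graph n)"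
  define xs where "xs = coloring_type G k f"
  define ys where "ys = coloring_type G k f'"
  define x where "x i = rev xs ! (i - 1)" for i
  define y where "y i = rev ys ! (i - 1)" for i
  have f: "coloring G k f" and f': "surj_coloring G k f'"
    using assms(3,4) by (auto simp: weak_maximizer_def surj_coloring_def G_def)
  have sorted: "sorted xs" "sorted ys" and len: "length xs = k" "length ys = k"
    by (auto simp: xs_def ys_def coloring_type_def)
  have decr: "decr_component (map real zs) i = real (rev zs ! (i - 1))"
    if "sorted zs" "length zs = k" "i \<in> {1..k}" for zs i
  proof -
    have "sort (map real zs) = map real zs"
      using that(1) by (intro sorted_sort_id) (simp add: sorted_map)
    moreover have "i - 1 < length (rev zs)" using that(2,3) by auto
    ultimately show ?thesis by (simp only: decr_component_def rev_map nth_map)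
  qed
  have antimono: "antimono_on {1..k} (\<lambda>i. rev zs ! (i - 1))" if "sorted zs" "length zs = k" for zs :: "nat list"
  proof (rule monotone_onI)
    fix a b assume "a \<in> {1..k}" "b \<in> {1..k}" "a \<le> b"
    then show "rev zs ! (b - 1) \<le> rev zs ! (a - 1)"
      using that by (auto simp: rev_nth intro!: sorted_nth_mono)
  qed
  have prefix: "(\<Sum>j=1..s. decr_component (map real zs) j) = real (\<Sum>i=1..s. rev zs ! (i - 1))"
    if "sorted zs" "length zs = k" "s \<le> k" for zs s
    unfolding of_nat_sum using that by (intro sum.cong) (auto simp: decr)
  have total: "(\<Sum>i=1..k. x i) = (\<Sum>i=1..k. y i)"
    using assms(5) sorted len prefix[of _ k]
    unfolding majorized_def G_def[symmetric] xs_def[symmetric] ys_def[symmetric] x_def y_def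
    by (metis order_refl of_nat_eq_iff)
  have sums: "(\<Sum>i=1..s. x i) \<le> (\<Sum>i=1..s. y i)" if s: "s \<le> k" for s
  proof -
    consider "s = 0" | "s \<in> {1..k - 1}" | "s = k" using s by fastforce
    then show ?thesis
    proof cases
      case 2
      then have "real (\<Sum>i=1..s. x i) \<le> real (\<Sum>i=1..s. y i)"
        using assms(5) sorted len prefix[of _ s] s
        unfolding majorized_def G_def[symmetric] xs_def[symmetric] ys_def[symmetric] x_def y_def
        by metis
      then show ?thesis by (simp only: of_nat_le_iff)
    qed (use total in auto)
  qed
  have ne: "\<exists>i\<in>{1..k}. x i \<noteq> y i"
  proof (rule ccontr)
    assume "\<not> ?thesis"
    then have "rev xs ! m = rev ys ! m" if "m < k" for m
      using that by (force simp: x_def y_def dest: bspec[of _ _ "Suc m"])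
    then have "rev xs = rev ys" using len by (intro nth_equalityI) auto
    then show False using assms(6) by (simp add: xs_def ys_def G_def)
  qed
  obtain h where h: "coloring G k h" "wiener_coloring G k h = wiener_coloring G k f"
    "\<forall>i\<in>{1..k}. card (color_class G h i) = x i"
    using relabel_by_decreasing_size[OF f] by (auto simp: x_def xs_def)
  have hsum: "(\<Sum>i=1..s. card (color_class G h i)) = (\<Sum>i=1..s. x i)" if "s \<le> k" for s
    using h(3) that by (intro sum.cong) auto
  have "antimono_on {1..k} (\<lambda>i. card (color_class G h i))"
    using antimono[OF sorted(1) len(1)] h(3) by (simp add: monotone_on_def x_def)
  then obtain g where g: "coloring G k g" "\<forall>i\<in>{1..k}. card (color_class G g i) = y i"
    "wiener_coloring G k f < wiener_coloring G k g"
    using exists_better_coloring_majorizing[of n k h y] h antimono[OF sorted(2) len(2)] hsum sums total ne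
    unfolding G_def y_def by auto
  \<comment> \<open>The coloring \<open>g\<close> competes with \<open>f'\<close> only if it is surjective, that is, if all prescribed sizes are
    positive; they are, being the class sizes of the surjective coloring \<open>f'\<close>.\<close>
  have ypos: "0 < y i" if "i \<in> {1..k}" for i
  proof -
    have "y i \<in> set ys" using that len nth_mem[of "i - 1" "rev ys"] by (auto simp: y_def)
    also have "set ys = (\<lambda>c. card (color_class G f' c)) ` {1..k}"
      unfolding ys_def coloring_type_def by (simp add: atLeastLessThanSuc_atLeastAtMost del: upt_Suc)
    finally obtain c where c: "c \<in> {1..k}" "y i = card (color_class G f' c)" by blast
    have "c \<in> f' ` verts G" using f' c(1) by (simp add: surj_coloring_def)
    then have "color_class G f' c \<noteq> {}" by (auto simp: color_class_def)
    moreover have "finite (color_class G f' c)"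
      by (simp add: color_class_def G_def path_graph_simps)
    ultimately show ?thesis using c(2) by (simp add: card_gt_0_iff)
  qed
  have "surj_coloring G k g"
  proof -
    have "i \<in> g ` verts G" if "i \<in> {1..k}" for i
    proof -
      have "0 < card (color_class G g i)" using ypos[OF that] g(2) that by simp
      then have "color_class G g i \<noteq> {}" by (simp add: card_gt_0_iff)
      then show ?thesis by (auto simp: color_class_def)
    qed
    then show ?thesis using g(1) by (auto simp: surj_coloring_def coloring_def)
  qed
  moreover have "coloring_type G k g = coloring_type G k f'"
  proof -
    have "map (\<lambda>i. card (color_class G g i)) [1..<k + 1] = rev ys"
      using g(2) len by (intro nth_equalityI) (auto simp: y_def nth_append simp del: upt_Suc)
    then have "coloring_type G k g = sort (rev ys)" by (simp only: coloring_type_def)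
    also have "\<dots> = ys" using sorted(2) by (intro properties_for_sort) auto
    finally show ?thesis by (simp add: ys_def)
  qed
  ultimately have "wiener_coloring G k g \<le> wiener_coloring G k f'"
    using assms(4) by (auto simp: weak_maximizer_def G_def)
  then show ?thesis using g(3) by (simp add: G_def)
qed

end
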